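(* Let $m\ge 2$, let $H\le\mathrm{Sym}(m)$, and let $G\le W_H$ be a weakly regular branch closed subgroup. Then $G$ is a closed, self-similar, level-transitive subgroup of $W_H$ with positive Hausdorff dimension in $W_H$.
   Context: Let $T$ be the $m$-adic rooted tree, identified with the free monoid on $\{1,\dots,m\}$ (vertices are finite words, level $n$ consists of the words of length $n$). $\mathrm{Aut}\,T$ is the group of automorphisms of the rooted tree $T$ (acting on the right), a profinite group whose topology has the level stabilizers as a base of neighbourhoods of $1$; "closed" refers to this topology. For $g\in\mathrm{Aut}\,T$ and a vertex $v$, the section $g|_v\in\mathrm{Aut}\,T$ is defined by $(vu)^g=v^g u^{g|_v}$ for all $u\in T$; $g|_v^1\in\mathrm{Sym}(m)$ denotes the permutation of $\{1,\dots,m\}$ induced by $g|_v$ on level 1. The iterated wreath product is $W_H=\{g\in\mathrm{Aut}\,T : g|_v^1\in H \text{ for all } v\in T\}$. For $G\le\mathrm{Aut}\,T$, $\mathrm{St}_G(n)$ is the subgroup of elements of $G$ fixing every vertex of level $n$. $G$ is level-transitive if it acts transitively on every level, and self-similar if $g|_v\in G$ for all $g\in G$, $v\in T$. Let $\psi$ be the monomorphism from the stabilizer of level 1 in $\mathrm{Aut}\,T$ to $\mathrm{Aut}\,T\times\overset{m}{\cdots}\times\mathrm{Aut}\,T$ given by $g\mapsto(g|_1,\dots,g|_m)$. A self-similar level-transitive group $G$ is weakly regular branch if it has a non-trivial subgroup $K\le G$ (a branching subgroup) such that $\psi(\mathrm{St}_K(1))\ge K\times\overset{m}{\cdots}\times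 K$. Hausdorff dimension of a closed subgroup $G\le W_H$ in $W_H$ is with respect to the level-stabilizer filtration: $\mathrm{hdim}_{W_H}(G)=\liminf_{n\to\infty}\frac{\log|G:\mathrm{St}_G(n)|}{\log|W_H:\mathrm{St}_{W_H}(n)|}$. *)

theory Defs
  imports "HOL-Analysis.Analysis" "HOL-Algebra.Sym_Groups" "HOL-Algebra.Product_Groups"
begin

section \<open>The rooted tree and its automorphism group\<close>

definition tree :: "nat \<Rightarrow> nat list set"
  where "tree m = lists {1..m}"

definition tree_adj :: "nat list \<Rightarrow> nat list \<Rightarrow> bool"
  where "tree_adj u v \<longleftrightarrow> (\<exists>i. v = u @ [i] \<or> u = v @ [i])"

text \<open>
  An automorphism is a total function on words that is the identity outside the tree (this is
  part of \<^const>\<open>permutes\<close>), so that equality of automorphisms is equality of functions.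
\<close>

definition tree_aut :: "nat \<Rightarrow> (nat list \<Rightarrow> nat list) \<Rightarrow> bool"
  where "tree_aut m g \<longleftrightarrow> g permutes tree m \<and> g [] = [] \<and>
    (\<forall>u\<in>tree m. \<forall>v\<in>tree m. tree_adj (g u) (g v) \<longleftrightarrow> tree_adj u v)"

text \<open>
  Automorphisms act on the right: the image $v^g$ is written \<open>g v\<close>, so the product of \<open>g\<close> and \<open>h\<close>
  applies \<open>g\<close> first.
\<close>

definition Aut_tree :: "nat \<Rightarrow> (nat list \<Rightarrow> nat list) monoid"
  where "Aut_tree m = \<lparr>carrier = {g. tree_aut m g}, mult = (\<lambda>g h. h \<circ> g), one = id\<rparr>"

text \<open>
  The image of \<open>v @ u\<close> under an automorphism \<open>g\<close> begins with \<open>g v\<close>, which has the length of \<open>v\<close>;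
  the section is what remains. See \<open>section_eq\<close> and \<open>tree_aut_section\<close> below.
\<close>

definition section_at :: "(nat list \<Rightarrow> nat list) \<Rightarrow> nat list \<Rightarrow> nat list \<Rightarrow> nat list"
  where "section_at g v = (\<lambda>u. drop (length v) (g (v @ u)))"

definition level1_perm :: "(nat list \<Rightarrow> nat list) \<Rightarrow> nat \<Rightarrow> nat"
  where "level1_perm g = (\<lambda>i. hd (g [i]))"

text \<open>
  \<^const>\<open>sym_group\<close> composes functions in the opposite order to the right action, but a set of
  permutations is a subgroup for one order if and only if it is one for the other.
\<close>

definition wreath_set :: "nat \<Rightarrow> (nat \<Rightarrow> nat) set \<Rightarrow> (nat list \<Rightarrow> nat list) set"
  where "wreath_set m H =
    {g \<in> carrier (Aut_tree m). \<forall>v\<in>tree m. level1_perm (section_at g v) \<in> H}"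

definition wreath_group :: "nat \<Rightarrow> (nat \<Rightarrow> nat) set \<Rightarrow> (nat list \<Rightarrow> nat list) monoid"
  where "wreath_group m H = (Aut_tree m)\<lparr>carrier := wreath_set m H\<rparr>"

definition level_stab :: "nat \<Rightarrow> (nat list \<Rightarrow> nat list) set \<Rightarrow> nat \<Rightarrow> (nat list \<Rightarrow> nat list) set"
  where "level_stab m G n = {g \<in> G. \<forall>v\<in>tree m. length v = n \<longrightarrow> g v = v}"

text \<open>
  The topology with the cosets of the level stabilizers as a base; see \<open>openin_Aut_topology\<close>.
\<close>

definition Aut_topology :: "nat \<Rightarrow> (nat list \<Rightarrow> nat list) topology"
  where "Aut_topology m = topology_generated_by
    {level_stab m (carrier (Aut_tree m)) n #>\<^bsub>Aut_tree m\<^esub> g | n g. g \<in> carrier (Aut_tree m)}"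


section \<open>Weakly regular branch groups\<close>

definition level_transitive :: "nat \<Rightarrow> (nat list \<Rightarrow> nat list) set \<Rightarrow> bool"
  where "level_transitive m G \<longleftrightarrow>
    (\<forall>n. \<forall>u\<in>tree m. \<forall>v\<in>tree m. length u = n \<and> length v = n \<longrightarrow> (\<exists>g\<in>G. g u = v))"

definition self_similar :: "nat \<Rightarrow> (nat list \<Rightarrow> nat list) set \<Rightarrow> bool"
  where "self_similar m G \<longleftrightarrow> (\<forall>g\<in>G. \<forall>v\<in>tree m. section_at g v \<in> G)"

text \<open>
  The target is the carrier of \<open>product_group {1..m} (\<lambda>_. Aut_tree m)\<close>, whose elements are
  extensional functions on \<open>{1..m}\<close>.
\<close>

definition psi :: "nat \<Rightarrow> (nat list \<Rightarrow> nat list) \<Rightarrow> nat \<Rightarrow> nat list \<Rightarrow> nat list"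
  where "psi m g = (\<lambda>i\<in>{1..m}. section_at g [i])"

definition branching_subgroup ::
    "nat \<Rightarrow> (nat list \<Rightarrow> nat list) set \<Rightarrow> (nat list \<Rightarrow> nat list) set \<Rightarrow> bool"
  where "branching_subgroup m G K \<longleftrightarrow>
    subgroup K ((Aut_tree m)\<lparr>carrier := G\<rparr>) \<and> K \<noteq> {\<one>\<^bsub>Aut_tree m\<^esub>} \<and>
    (\<Pi>\<^sub>E i\<in>{1..m}. K) \<subseteq> psi m ` level_stab m K 1"

definition weakly_regular_branch :: "nat \<Rightarrow> (nat list \<Rightarrow> nat list) set \<Rightarrow> bool"
  where "weakly_regular_branch m G \<longleftrightarrow>
    subgroup G (Aut_tree m) \<and> self_similar m G \<and> level_transitive m G \<and>
    (\<exists>K. branching_subgroup m G K)"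


section \<open>Hausdorff dimension\<close>

definition level_index :: "nat \<Rightarrow> (nat list \<Rightarrow> nat list) set \<Rightarrow> nat \<Rightarrow> nat"
  where "level_index m G n =
    card (rcosets\<^bsub>(Aut_tree m)\<lparr>carrier := G\<rparr>\<^esub> (level_stab m G n))"

text \<open>
  The set of cosets in \<^const>\<open>level_index\<close> is finite (\<open>finite_level_cosets\<close>). If \<open>H\<close> is trivial,
  then all the quotients below are \<open>0 / 0 = 0\<close>; in general this happens at least for \<open>n = 0\<close>.
\<close>

definition hdim :: "nat \<Rightarrow> (nat \<Rightarrow> nat) set \<Rightarrow> (nat list \<Rightarrow> nat list) set \<Rightarrow> ereal"
  where "hdim m H G =
    liminf (\<lambda>n. ereal (ln (real (level_index m G n)) / ln (real (level_index m (wreath_set m H) n))))"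


section \<open>The notions above are well-defined\<close>

lemma tree_Nil [simp]: "[] \<in> tree m"
  by (simp add: tree_def)

lemma tree_append [simp]: "u @ v \<in> tree m \<longleftrightarrow> u \<in> tree m \<and> v \<in> tree m"
  by (auto simp: tree_def)

lemma tree_autD:
  assumes "tree_aut m g"
  shows "g permutes tree m" "g [] = []"
    "\<And>u v. u \<in> tree m \<Longrightarrow> v \<in> tree m \<Longrightarrow> tree_adj (g u) (g v) \<longleftrightarrow> tree_adj u v"
    "\<And>u. g u \<in> tree m \<longleftrightarrow> u \<in> tree m" "inj g"
  using assms unfolding tree_aut_def by (auto simp: permutes_in_image dest: permutes_inj)

lemma tree_aut_length:
  assumes g: "tree_aut m g" and "u \<in> tree m"
  shows "length (g u) = length u"
  using \<open>u \<in> tree m\<close>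
proof (induction u rule: length_induct)
  case (1 u)
  show ?case
  proof (cases u rule: rev_cases)
    case Nil
    then show ?thesis using tree_autD[OF g] by simp
  next
    case (snoc v i)
    have v: "v \<in> tree m" using snoc 1 by simp
    have lv: "length (g v) = length v" using 1 snoc v by simp
    have "tree_adj v u" using snoc by (auto simp: tree_adj_def)
    then have "tree_adj (g v) (g u)" using tree_autD(3)[OF g v] 1 by simp
    then consider j where "g u = g v @ [j]" | j where "g v = g u @ [j]"
      by (auto simp: tree_adj_def)
    then show ?thesis
    proof cases
      case 1
      then show ?thesis using lv snoc by simp
    next
      case up: (2 j)
      have "v \<noteq> []" using up tree_autD[OF g] by auto
      then obtain w k where w: "v = w @ [k]" by (cases v rule: rev_cases) auto
      have wt: "w \<in> tree m" using w v by simp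
      have lw: "length (g w) = length w" using 1 snoc w wt by simp
      have "tree_adj w v" using w by (auto simp: tree_adj_def)
      then have "tree_adj (g w) (g v)" using tree_autD(3)[OF g wt v] by simp
      then obtain l where "g v = g w @ [l]" using lw lv w by (auto simp: tree_adj_def)
      then have "g w = g u" using up by simp
      then have "w = u" using tree_autD(5)[OF g] by (auto dest: injD)
      then show ?thesis using w snoc by simp
    qed
  qed
qed

lemma tree_aut_take:
  assumes g: "tree_aut m g" and "v \<in> tree m" "u \<in> tree m"
  shows "take (length v) (g (v @ u)) = g v"
  using \<open>u \<in> tree m\<close>
proof (induction u rule: rev_induct)
  case Nil
  then show ?case using tree_aut_length[OF g \<open>v \<in> tree m\<close>] by simp
next
  case (snoc i u)
  have u: "v @ u \<in> tree m" "v @ u @ [i] \<in> tree m" using snoc assms by simp_all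
  have "tree_adj (v @ u) (v @ u @ [i])" by (auto simp: tree_adj_def)
  then have "tree_adj (g (v @ u)) (g (v @ u @ [i]))" using tree_autD(3)[OF g u] by simp
  then obtain j where "g (v @ u @ [i]) = g (v @ u) @ [j]"
    using tree_aut_length[OF g u(1)] tree_aut_length[OF g u(2)] by (auto simp: tree_adj_def)
  then show ?case using snoc tree_aut_length[OF g u(1)] by simp
qed

lemma section_eq:
  assumes "tree_aut m g" "v \<in> tree m" "u \<in> tree m"
  shows "g (v @ u) = g v @ section_at g v u"
  using tree_aut_take[OF assms] unfolding section_at_def by (metis append_take_drop_id)

lemma tree_aut_id: "tree_aut m id"
  by (simp add: tree_aut_def permutes_id)

lemma tree_aut_comp: "tree_aut m g \<Longrightarrow> tree_aut m h \<Longrightarrow> tree_aut m (h \<circ> g)"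
  unfolding tree_aut_def by (auto simp: permutes_compose permutes_in_image)

lemma tree_aut_inv:
  assumes g: "tree_aut m g" shows "tree_aut m (inv' g)"
proof -
  have p: "g permutes tree m" using tree_autD[OF g] by simp
  have q: "inv' g permutes tree m" using p by (rule permutes_inv)
  have "inv' g [] = []" using tree_autD(2,5)[OF g] by (metis inv_f_f)
  moreover have "tree_adj (inv' g u) (inv' g v) \<longleftrightarrow> tree_adj u v"
    if "u \<in> tree m" "v \<in> tree m" for u v
    using tree_autD(3)[OF g, of "inv' g u" "inv' g v"] that permutes_in_image[OF q]
    by (simp add: permutes_inverses[OF p])
  ultimately show ?thesis using q by (simp add: tree_aut_def)
qed

lemma group_Aut_tree: "group (Aut_tree m)"
proof (rule groupI)
  fix g assume "g \<in> carrier (Aut_tree m)"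
  then have "tree_aut m g" by (simp add: Aut_tree_def)
  then show "\<exists>h\<in>carrier (Aut_tree m). h \<otimes>\<^bsub>Aut_tree m\<^esub> g = \<one>\<^bsub>Aut_tree m\<^esub>"
    using tree_aut_inv[of m g] permutes_inv_o[OF tree_autD(1), of m g]
    by (auto simp: Aut_tree_def intro!: bexI[of _ "inv' g"])
qed (auto simp: Aut_tree_def tree_aut_id intro: tree_aut_comp[unfolded o_def] simp: o_def)

lemma tree_aut_section:
  assumes g: "tree_aut m g" and v: "v \<in> tree m"
  shows "tree_aut m (section_at g v)"
proof -
  let ?s = "section_at g v" and ?t = "section_at (inv' g) (g v)"
  note h = tree_aut_inv[OF g]
  note p = tree_autD(1)[OF g]
  have gv: "g v \<in> tree m" using tree_autD[OF g] v by simp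
  have lv: "length (g v) = length v" using tree_aut_length[OF g v] .
  have out: "?s u = u" if "u \<notin> tree m" for u
    using that permutes_not_in[OF p, of "v @ u"] by (simp add: section_at_def)
  have sin: "?s u \<in> tree m" if "u \<in> tree m" for u
    using section_eq[OF g v that] tree_autD(4)[OF g, of "v @ u"] v that by simp
  have tin: "?t u \<in> tree m" if "u \<in> tree m" for u
    using section_eq[OF h gv that] tree_autD(4)[OF h, of "g v @ u"] gv that by simp
  have ts: "?t (?s u) = u" if "u \<in> tree m" for u
    using section_eq[OF g v that, symmetric] lv
    by (simp add: section_at_def[of "inv' g"] permutes_inverses[OF p])
  have st: "?s (?t u) = u" if "u \<in> tree m" for u
    using section_eq[OF h gv that, symmetric] lv
    by (simp add: section_at_def[of g] permutes_inverses[OF p])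
  have "?s permutes tree m"
    by (rule bij_imp_permutes) (auto intro!: bij_betwI[where g = ?t] simp: sin tin ts st out)
  moreover have "?s [] = []" using lv by (simp add: section_at_def)
  moreover have "tree_adj (?s a) (?s b) \<longleftrightarrow> tree_adj a b" if "a \<in> tree m" "b \<in> tree m" for a b
  proof -
    have app: "tree_adj (w @ x) (w @ y) \<longleftrightarrow> tree_adj x y" for w x y
      by (simp add: tree_adj_def)
    show ?thesis
      using tree_autD(3)[OF g, of "v @ a" "v @ b"] that v section_eq[OF g v] by (simp add: app)
  qed
  ultimately show ?thesis by (simp add: tree_aut_def)
qed

lemma level1_perm_singleton:
  assumes g: "tree_aut m g" shows "g [i] = [level1_perm g i]"
proof (cases "[i] \<in> tree m")
  case True
  then show ?thesis
    using tree_aut_length[OF g True] by (cases "g [i]") (auto simp: level1_perm_def)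
next
  case False
  then show ?thesis
    using permutes_not_in[OF tree_autD(1)[OF g]] by (simp add: level1_perm_def)
qed

lemma level1_perm_permutes:
  assumes g: "tree_aut m g" shows "level1_perm g permutes {1..m}"
proof -
  note g1 = level1_perm_singleton[OF g]
  have "inj (level1_perm g)"
    using tree_autD(5)[OF g] g1 by (metis injI injD list.inject)
  moreover have "level1_perm g i \<in> {1..m}" if "i \<in> {1..m}" for i
    using tree_autD(4)[OF g, of "[i]"] g1[of i] that by (simp add: tree_def)
  ultimately have "bij_betw (level1_perm g) {1..m} {1..m}"
    by (intro endo_inj_surj[THEN bij_betw_imageI[rotated]])
       (auto intro: inj_on_subset)
  moreover have "level1_perm g i = i" if "i \<notin> {1..m}" for i
    using permutes_not_in[OF tree_autD(1)[OF g], of "[i]"] that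
    by (simp add: level1_perm_def tree_def)
  ultimately show ?thesis by (rule bij_imp_permutes)
qed

lemma level_stab_antimono:
  assumes G: "\<And>g. g \<in> G \<Longrightarrow> tree_aut m g" and m: "m \<ge> 1" and "n \<le> k"
  shows "level_stab m G k \<subseteq> level_stab m G n"
proof
  fix g assume g: "g \<in> level_stab m G k"
  have "g v = v" if v: "v \<in> tree m" "length v = n" for v
  proof -
    let ?w = "replicate (k - n) (1::nat)"
    have w: "?w \<in> tree m" using m by (auto simp: tree_def)
    have "g (v @ ?w) = v @ ?w" using g v w \<open>n \<le> k\<close> by (simp add: level_stab_def)
    then show ?thesis
      using tree_aut_take[of m g v ?w] g G v w by (simp add: level_stab_def)
  qed
  then show "g \<in> level_stab m G n" using g by (simp add: level_stab_def)
qed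

lemma mem_level_coset:
  assumes "tree_aut m g"
  shows "f \<in> level_stab m (carrier (Aut_tree m)) n #>\<^bsub>Aut_tree m\<^esub> g \<longleftrightarrow>
    tree_aut m f \<and> (\<forall>v\<in>tree m. length v = n \<longrightarrow> f v = g v)"
proof
  assume "f \<in> level_stab m (carrier (Aut_tree m)) n #>\<^bsub>Aut_tree m\<^esub> g"
  then show "tree_aut m f \<and> (\<forall>v\<in>tree m. length v = n \<longrightarrow> f v = g v)"
    using assms by (auto simp: r_coset_def level_stab_def Aut_tree_def tree_aut_comp)
next
  assume f: "tree_aut m f \<and> (\<forall>v\<in>tree m. length v = n \<longrightarrow> f v = g v)"
  have p: "g permutes tree m" using tree_autD[OF assms] by simp
  have "f = g \<circ> (inv' g \<circ> f)" using permutes_inv_o[OF p] by (simp add: o_assoc)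
  moreover have "tree_aut m (inv' g \<circ> f)" using f assms by (simp add: tree_aut_comp tree_aut_inv)
  moreover have "(inv' g \<circ> f) v = v" if "v \<in> tree m" "length v = n" for v
    using f that by (simp add: permutes_inverses[OF p])
  ultimately show "f \<in> level_stab m (carrier (Aut_tree m)) n #>\<^bsub>Aut_tree m\<^esub> g"
    unfolding r_coset_def level_stab_def by (auto simp: Aut_tree_def)
qed

lemma openin_Aut_topology:
  assumes m: "m \<ge> 1"
  shows "openin (Aut_topology m) U \<longleftrightarrow> U \<subseteq> carrier (Aut_tree m) \<and>
    (\<forall>g\<in>U. \<exists>n. level_stab m (carrier (Aut_tree m)) n #>\<^bsub>Aut_tree m\<^esub> g \<subseteq> U)"
    (is "?L U \<longleftrightarrow> ?R U")
proof
  let ?A = "carrier (Aut_tree m)"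
  let ?C = "\<lambda>n g. level_stab m ?A n #>\<^bsub>Aut_tree m\<^esub> g"
  have A: "g \<in> ?A \<longleftrightarrow> tree_aut m g" for g by (simp add: Aut_tree_def)
  have anti: "?C k g \<subseteq> ?C n g" if "n \<le> k" for n k g
    using level_stab_antimono[of ?A m n k] m that by (auto simp: r_coset_def A)
  {
    assume "?L U"
    then have "generate_topology_on {?C n g | n g. g \<in> ?A} U"
      by (simp add: Aut_topology_def openin_topology_generated_by_iff)
    then show "?R U"
    proof induction
      case Empty
      then show ?case by simp
    next
      case (Int a b)
      show ?case
      proof (intro conjI ballI)
        fix g assume "g \<in> a \<inter> b"
        then obtain n k where "?C n g \<subseteq> a" "?C k g \<subseteq> b" using Int by blast
        then have "?C (max n k) g \<subseteq> a \<inter> b"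
          using anti[of n "max n k" g] anti[of k "max n k" g] by auto
        then show "\<exists>n. ?C n g \<subseteq> a \<inter> b" by blast
      qed (use Int in blast)
    next
      case (UN K)
      then show ?case by (meson Sup_upper Sup_least UnionE order_trans)
    next
      case (Basis s)
      then obtain n g where s: "s = ?C n g" and g: "tree_aut m g" using A by blast
      have "?C n f \<subseteq> s" if "f \<in> s" for f
        using that mem_level_coset[OF g] mem_level_coset[of m f] by (auto simp: s)
      moreover have "s \<subseteq> ?A" using mem_level_coset[OF g] by (auto simp: s A)
      ultimately show ?case by blast
    qed
  }
  {
    assume R: "?R U"
    have "\<exists>T. openin (Aut_topology m) T \<and> g \<in> T \<and> T \<subseteq> U" if "g \<in> U" for g
    proof -
      from R that obtain n where n: "?C n g \<subseteq> U" and g: "g \<in> ?A" by blast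
      have "openin (Aut_topology m) (?C n g)"
        unfolding Aut_topology_def using g by (intro topology_generated_by_Basis) blast
      moreover have "g \<in> ?C n g" using mem_level_coset[of m g g n] g A by blast
      ultimately show ?thesis using n by blast
    qed
    then show "?L U" by (subst openin_subopen) blast
  }
qed

lemma section_at_comp:
  assumes g: "tree_aut m g" and h: "tree_aut m h" and v: "v \<in> tree m"
  shows "section_at (h \<circ> g) v = section_at h (g v) \<circ> section_at g v"
proof
  fix u
  have l: "length (g v) = length v" using tree_aut_length[OF g v] .
  show "section_at (h \<circ> g) v u = (section_at h (g v) \<circ> section_at g v) u"
  proof (cases "u \<in> tree m")
    case True
    then show ?thesis using section_eq[OF g v True] l by (simp add: section_at_def)
  next
    case False
    have "k (w @ u) = w @ u" if "tree_aut m k" for k w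
      using False permutes_not_in[OF tree_autD(1)[OF that], of "w @ u"] by simp
    from this[OF g] this[OF h] show ?thesis using l by (simp add: section_at_def)
  qed
qed

lemma psi_hom:
  "psi m \<in> hom ((Aut_tree m)\<lparr>carrier := level_stab m (carrier (Aut_tree m)) 1\<rparr>)
    (product_group {1..m} (\<lambda>_. Aut_tree m))"
proof (rule homI)
  fix g assume "g \<in> carrier ((Aut_tree m)\<lparr>carrier := level_stab m (carrier (Aut_tree m)) 1\<rparr>)"
  then show "psi m g \<in> carrier (product_group {1..m} (\<lambda>_. Aut_tree m))"
    by (auto simp: psi_def level_stab_def Aut_tree_def tree_def carrier_product_group
        intro!: tree_aut_section)
next
  fix g h
  let ?S = "(Aut_tree m)\<lparr>carrier := level_stab m (carrier (Aut_tree m)) 1\<rparr>"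
  assume "g \<in> carrier ?S" "h \<in> carrier ?S"
  then have g: "tree_aut m g" "\<And>i. i \<in> {1..m} \<Longrightarrow> g [i] = [i]" and h: "tree_aut m h"
    by (auto simp: level_stab_def Aut_tree_def tree_def)
  have "section_at (h \<circ> g) [i] = section_at h [i] \<circ> section_at g [i]" if i: "i \<in> {1..m}" for i
    using section_at_comp[OF g(1) h, of "[i]"] g(2)[OF i] i by (simp add: tree_def)
  then show "psi m (g \<otimes>\<^bsub>?S\<^esub> h) = psi m g \<otimes>\<^bsub>product_group {1..m} (\<lambda>_. Aut_tree m)\<^esub> psi m h"
    by (auto simp: psi_def Aut_tree_def)
qed

lemma level_coset_subgroup:
  assumes G: "subgroup G (Aut_tree m)" and g: "g \<in> G"
  shows "level_stab m G n #>\<^bsub>(Aut_tree m)\<lparr>carrier := G\<rparr>\<^esub> g =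
    {f \<in> G. \<forall>v\<in>tree m. length v = n \<longrightarrow> f v = g v}" (is "?c = ?R")
proof
  interpret A: group "Aut_tree m" by (rule group_Aut_tree)
  have G': "h \<in> G \<Longrightarrow> tree_aut m h" for h
    using subgroup.subset[OF G] by (auto simp: Aut_tree_def)
  show "?c \<subseteq> ?R"
    using subgroup.m_closed[OF G] g
    by (auto simp: r_coset_def level_stab_def Aut_tree_def)
  show "?R \<subseteq> ?c"
  proof
    fix f assume f: "f \<in> ?R"
    let ?h = "f \<otimes>\<^bsub>Aut_tree m\<^esub> inv\<^bsub>Aut_tree m\<^esub> g"
    have car: "f \<in> carrier (Aut_tree m)" "g \<in> carrier (Aut_tree m)"
      using f g subgroup.subset[OF G] by auto
    have hG: "?h \<in> G"
      using f g subgroup.m_closed[OF G] subgroup.m_inv_closed[OF G] by auto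
    have fg: "f = ?h \<otimes>\<^bsub>Aut_tree m\<^esub> g"
      using car by (simp add: A.m_assoc)
    then have fh: "f = g \<circ> ?h" by (simp add: Aut_tree_def)
    have "?h v = v" if "v \<in> tree m" "length v = n" for v
    proof -
      have "g (?h v) = g v" using f that fh by (metis (mono_tags, lifting) comp_apply mem_Collect_eq)
      then show ?thesis using tree_autD(5)[OF G'[OF g]] by (auto dest: injD)
    qed
    then have "?h \<in> level_stab m G n" using hG by (simp add: level_stab_def)
    then show "f \<in> ?c" using fg by (auto simp: r_coset_def)
  qed
qed

lemma finite_level_cosets:
  assumes G: "subgroup G (Aut_tree m)"
  shows "finite (rcosets\<^bsub>(Aut_tree m)\<lparr>carrier := G\<rparr>\<^esub> (level_stab m G n))"
proof -
  let ?L = "{v \<in> tree m. length v = n}"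
  let ?F = "\<lambda>r. {f \<in> G. \<forall>v\<in>?L. f v = r v}"
  have fin: "finite ?L"
    using finite_lists_length_eq[of "{1..m}" n] by (simp add: tree_def lists_eq_set)
  have A: "tree_aut m g" if "g \<in> G" for g
    using that subgroup.subset[OF G] by (auto simp: Aut_tree_def)
  have "rcosets\<^bsub>(Aut_tree m)\<lparr>carrier := G\<rparr>\<^esub> (level_stab m G n) \<subseteq> ?F ` (\<Pi>\<^sub>E v\<in>?L. ?L)"
  proof
    fix C assume "C \<in> rcosets\<^bsub>(Aut_tree m)\<lparr>carrier := G\<rparr>\<^esub> (level_stab m G n)"
    then obtain g where g: "g \<in> G" "C = level_stab m G n #>\<^bsub>(Aut_tree m)\<lparr>carrier := G\<rparr>\<^esub> g"
      by (auto simp: RCOSETS_def)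
    have "C = ?F (restrict g ?L)"
      unfolding g(2) level_coset_subgroup[OF G g(1)] by auto
    moreover have "restrict g ?L \<in> (\<Pi>\<^sub>E v\<in>?L. ?L)"
      using A[OF g(1)] by (auto simp: tree_autD(4) tree_aut_length)
    ultimately show "C \<in> ?F ` (\<Pi>\<^sub>E v\<in>?L. ?L)" by blast
  qed
  then show ?thesis by (rule finite_subset) (intro finite_imageI finite_PiE fin)
qed

lemma level1_perm_comp:
  assumes "tree_aut m g" "tree_aut m h"
  shows "level1_perm (h \<circ> g) = level1_perm h \<circ> level1_perm g"
  using level1_perm_singleton[OF assms(1)] level1_perm_singleton[OF assms(2)]
    level1_perm_singleton[OF tree_aut_comp[OF assms]] by (auto simp: fun_eq_iff)

lemma subgroup_wreath_set:
  assumes H: "subgroup H (sym_group m)"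
  shows "subgroup (wreath_set m H) (Aut_tree m)"
proof -
  interpret A: group "Aut_tree m" by (rule group_Aut_tree)
  interpret S: group "sym_group m" by (rule sym_group_is_group)
  have W: "g \<in> wreath_set m H \<longleftrightarrow> tree_aut m g \<and> (\<forall>v\<in>tree m. level1_perm (section_at g v) \<in> H)" for g
    by (simp add: wreath_set_def Aut_tree_def)
  have idH: "id \<in> H" using subgroup.one_closed[OF H] by (simp add: sym_group_def)
  have sid: "section_at id v = id" for v by (auto simp: section_at_def)
  have lid: "level1_perm id = id" by (auto simp: level1_perm_def)
  have one: "\<one>\<^bsub>Aut_tree m\<^esub> \<in> wreath_set m H"
    by (simp add: W sid lid idH tree_aut_id) (simp add: Aut_tree_def tree_aut_id sid lid idH)
  have lc: "level1_perm (section_at (h \<circ> g) v) =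
      level1_perm (section_at h (g v)) \<circ> level1_perm (section_at g v)"
    if "tree_aut m g" "tree_aut m h" "v \<in> tree m" for g h v
  proof -
    have "g v \<in> tree m" using that tree_autD(4)[OF that(1)] by simp
    then show ?thesis
      using level1_perm_comp[OF tree_aut_section tree_aut_section] section_at_comp that by metis
  qed
  show ?thesis
  proof (rule A.subgroupI)
    show "wreath_set m H \<subseteq> carrier (Aut_tree m)" by (auto simp: wreath_set_def)
    show "wreath_set m H \<noteq> {}" using one by blast
  next
    fix g h assume "g \<in> wreath_set m H" "h \<in> wreath_set m H"
    then show "g \<otimes>\<^bsub>Aut_tree m\<^esub> h \<in> wreath_set m H"
      using subgroup.m_closed[OF H]
      by (auto simp: W lc tree_aut_comp tree_autD(4) Aut_tree_def sym_group_def)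
  next
    fix g assume g: "g \<in> wreath_set m H"
    let ?h = "inv\<^bsub>Aut_tree m\<^esub> g"
    have ga: "tree_aut m g" using g W by blast
    then have gc: "g \<in> carrier (Aut_tree m)" by (simp add: Aut_tree_def)
    then have ha: "tree_aut m ?h" using A.inv_closed[OF gc] by (simp add: Aut_tree_def)
    have gh: "g \<circ> ?h = id" using A.l_inv[OF gc] by (simp add: Aut_tree_def)
    have "level1_perm (section_at ?h v) \<in> H" if v: "v \<in> tree m" for v
    proof -
      let ?p = "level1_perm (section_at ?h v)" and ?q = "level1_perm (section_at g (?h v))"
      have "?q \<circ> ?p = id" using lc[OF ha ga v] by (simp add: gh sid lid)
      moreover have qH: "?q \<in> H" using g v ha by (simp add: W tree_autD(4))
      moreover have "?p \<in> carrier (sym_group m)" "?q \<in> carrier (sym_group m)"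
        using level1_perm_permutes[OF tree_aut_section[OF ha v]]
          level1_perm_permutes[OF tree_aut_section[OF ga, of "?h v"]] tree_autD(4)[OF ha] v
        by (simp_all add: sym_group_carrier)
      ultimately have "?p = inv\<^bsub>sym_group m\<^esub> ?q"
        using S.inv_equality[of ?q ?p] S.inv_inv by (metis sym_group_mult sym_group_one)
      then show ?thesis using subgroup.m_inv_closed[OF H qH] by simp
    qed
    then show "?h \<in> wreath_set m H" using ha by (simp add: W)
  qed
qed

end

theory Submission
  imports Defs
begin

text \<open>
  Let \<open>K\<close> be a branching subgroup. It moves some vertex, say of level \<open>d\<close>, and it contains an
  element with any prescribed \<open>m\<close>-tuple of sections from \<open>K\<close>, so the number of actions of \<open>K\<close>
  on a level is at least raised to the \<open>m\<close>-th power when passing to the next level. Hence \<open>K\<close>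
  acts on level \<open>d + j\<close> in at least \<open>2 ^ m ^ j\<close> ways, while the whole tree has at most
  \<open>m ^ m ^ (d + j + 1)\<close> automorphisms of that level. The quotient of the logarithms is bounded
  below independently of \<open>j\<close>.
\<close>

definition level :: "nat \<Rightarrow> nat \<Rightarrow> nat list set"
  where "level m n = {v \<in> tree m. length v = n}"

text \<open>Restricting makes these functions extensional, so equal actions are equal functions. The
  set models the quotient of \<open>G\<close> by the stabilizer of level \<open>n\<close>.\<close>

definition level_actions ::
    "nat \<Rightarrow> (nat list \<Rightarrow> nat list) set \<Rightarrow> nat \<Rightarrow> (nat list \<Rightarrow> nat list) set"
  where "level_actions m G n = (\<lambda>g. restrict g (level m n)) ` G"

lemma finite_level: "finite (level m n)"
  using finite_lists_length_eq[of "{1..m}" n] by (simp add: level_def tree_def lists_eq_set)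

lemma card_level: "card (level m n) = m ^ n"
  using card_lists_length_eq[of "{1..m}" n] by (simp add: level_def tree_def lists_eq_set)

lemma finite_level_actions:
  assumes "\<And>g. g \<in> G \<Longrightarrow> tree_aut m g"
  shows "finite (level_actions m G n)"
proof (rule finite_subset)
  have "g \<in> level m n \<rightarrow> level m n" if "g \<in> G" for g
    using assms[OF that] by (auto simp: level_def tree_autD(4) tree_aut_length)
  then show "level_actions m G n \<subseteq> (\<Pi>\<^sub>E v\<in>level m n. level m n)"
    unfolding level_actions_def by (intro image_subsetI) (simp add: restrict_PiE_iff Pi_iff)
qed (intro finite_PiE finite_level)

text \<open>Two elements of \<open>G\<close> lie in the same coset of the level stabilizer exactly
  when they agree on level \<open>n\<close>. This replaces cosets by functions, which are easier to
  count.\<close>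

lemma level_index_eq_card_level_actions:
  assumes G: "subgroup G (Aut_tree m)"
  shows "level_index m G n = card (level_actions m G n)"
proof -
  \<comment> \<open>\<open>?F r\<close> looks only at the values of \<open>r\<close> on the level,
    so it gives the same set for an element of \<open>G\<close> and for its restriction.\<close>
  let ?F = "\<lambda>r. {f \<in> G. \<forall>v\<in>level m n. f v = r v}"
  have "rcosets\<^bsub>(Aut_tree m)\<lparr>carrier := G\<rparr>\<^esub> (level_stab m G n) = (\<lambda>g. ?F g) ` G"
    using level_coset_subgroup[OF G, of _ n] by (auto simp: RCOSETS_def level_def)
  also have "\<dots> = ?F ` level_actions m G n"
    unfolding level_actions_def image_image by (intro image_cong) auto
  finally have eq: "rcosets\<^bsub>(Aut_tree m)\<lparr>carrier := G\<rparr>\<^esub> (level_stab m G n) = ?F ` level_actions m G n" .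
  have "inj_on ?F (level_actions m G n)"
  proof (rule inj_onI)
    fix r s assume r: "r \<in> level_actions m G n" and s: "s \<in> level_actions m G n" and rs: "?F r = ?F s"
    obtain g where g: "g \<in> G" "r = restrict g (level m n)" using r by (auto simp: level_actions_def)
    \<comment> \<open>Any member of \<open>?F s\<close> determines \<open>s\<close> on the level,
      and \<open>s\<close> is extensional; so one common member of the two sets suffices.\<close>
    have "g \<in> ?F r" using g by auto
    then have "g \<in> ?F s" using rs by simp
    moreover have "s \<in> extensional (level m n)" using s by (auto simp: level_actions_def)
    ultimately show "r = s" unfolding g(2) by (intro extensionalityI[of _ "level m n"]) auto
  qed
  then show ?thesis by (simp add: level_index_def eq card_image)
qed

text \<open>A crude bound for the number of words of length at most \<open>n\<close>. The factor
  lost here only affects the constant in the final estimate.\<close>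

lemma sum_powers_le:
  fixes m :: nat
  assumes "m \<ge> 2"
  shows "(\<Sum>i\<le>n. m ^ i) \<le> m ^ Suc n"
proof (induction n)
  case (Suc n)
  have "(\<Sum>i\<le>Suc n. m ^ i) \<le> 2 * m ^ Suc n" using Suc by simp
  also have "\<dots> \<le> m * m ^ Suc n" using assms by (intro mult_right_mono) auto
  finally show ?case by simp
qed (use assms in simp)

text \<open>
  The \<open>i\<close>-th letter of \<open>g v\<close> is the last letter of the image of the prefix of \<open>v\<close> of length
  \<open>i + 1\<close>, so the action on level \<open>n\<close> can be read off from one letter for each word of length at
  most \<open>n\<close>.
\<close>

lemma card_level_actions_le:
  assumes A: "\<And>g. g \<in> A \<Longrightarrow> tree_aut m g" and m: "m \<ge> 2"
  shows "card (level_actions m A n) \<le> m ^ m ^ Suc n"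
proof -
  \<comment> \<open>\<open>P\<close> omits the empty word, which has no last letter.
    \<open>p\<close> encodes an automorphism by its last letters on \<open>P\<close>, and
    \<open>D\<close> decodes this into the action on level \<open>n\<close>.\<close>
  define P where "P = (\<Union>i\<in>{1..n}. level m i)"
  define p where "p = (\<lambda>g :: nat list \<Rightarrow> nat list. restrict (\<lambda>v. last (g v)) P)"
  define D where "D = (\<lambda>q :: nat list \<Rightarrow> nat.
    restrict (\<lambda>v. map (\<lambda>i. q (take (Suc i) v)) [0..<n]) (level m n))"
  have finP: "finite P" unfolding P_def by (intro finite_UN_I finite_level) auto
  have "card P \<le> (\<Sum>i\<in>{1..n}. m ^ i)"
    unfolding P_def using card_UN_le[of "{1..n}" "level m"] by (simp add: card_level)
  also have "\<dots> \<le> (\<Sum>i\<le>n. m ^ i)" by (intro sum_mono2) auto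
  also have "\<dots> \<le> m ^ Suc n" by (rule sum_powers_le[OF m])
  finally have cP: "card P \<le> m ^ Suc n" .
  have "p ` A \<subseteq> (\<Pi>\<^sub>E v\<in>P. {1..m})"
  proof clarify
    fix g assume g: "g \<in> A"
    have "last (g v) \<in> {1..m}" if "v \<in> P" for v
    proof -
      have v: "v \<in> tree m" "v \<noteq> []" using that by (auto simp: P_def level_def)
      then have "g v \<in> tree m" "g v \<noteq> []"
        using tree_autD(4)[OF A[OF g]] tree_aut_length[OF A[OF g] v(1)] by auto
      then show ?thesis using last_in_set[of "g v"] unfolding tree_def lists_eq_set by blast
    qed
    then show "p g \<in> (\<Pi>\<^sub>E v\<in>P. {1..m})" by (auto simp: p_def)
  qed
  moreover have finE: "finite (\<Pi>\<^sub>E v\<in>P. {1..m})" by (intro finite_PiE finP) auto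
  ultimately have fin: "finite (p ` A)" and "card (p ` A) \<le> card (\<Pi>\<^sub>E v\<in>P. {1..m})"
    by (auto intro: finite_subset card_mono)
  then have cp: "card (p ` A) \<le> m ^ card P" using finP by (simp add: card_PiE)
  have "D (p g) = restrict g (level m n)" if g: "g \<in> A" for g
  proof
    fix v
    show "D (p g) v = restrict g (level m n) v"
    proof (cases "v \<in> level m n")
      case True
      then have v: "v \<in> tree m" "length v = n" by (auto simp: level_def)
      have "p g (take (Suc i) v) = g v ! i" if i: "i < n" for i
      proof -
        have t: "take (Suc i) v \<in> tree m" "drop (Suc i) v \<in> tree m"
          using v(1) by (auto simp: tree_def lists_eq_set dest: in_set_takeD in_set_dropD)
        have lt: "length (take (Suc i) v) = Suc i" using v(2) i by simp
        \<comment> \<open>For \<open>i < n\<close> the prefix length \<open>Suc i\<close> runs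
          through exactly \<open>{1..n}\<close>, the levels collected in \<open>P\<close>.\<close>
        have "take (Suc i) v \<in> P" using t lt i unfolding P_def level_def by fastforce
        then have "p g (take (Suc i) v) = last (g (take (Suc i) v))" by (simp add: p_def)
        also have "g (take (Suc i) v) = take (Suc i) (g v)"
          using tree_aut_take[OF A[OF g] t] lt by simp
        also have "last \<dots> = g v ! i"
          using i v(2) tree_aut_length[OF A[OF g] v(1)] by (simp add: take_Suc_conv_app_nth)
        finally show ?thesis .
      qed
      then have "D (p g) v = g v"
        using True v(2) tree_aut_length[OF A[OF g] v(1)] by (auto simp: D_def intro: nth_equalityI)
      then show ?thesis using True by simp
    qed (simp add: D_def)
  qed
  then have "level_actions m A n = D ` p ` A" by (simp add: level_actions_def image_image)
  then have "card (level_actions m A n) \<le> card (p ` A)" using fin by (simp add: card_image_le)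
  also have "\<dots> \<le> m ^ m ^ Suc n" using cp power_increasing[OF cP, of m] m by linarith
  finally show ?thesis .
qed

text \<open>Lift an \<open>m\<close>-tuple of actions on level \<open>n\<close> to elements of
  \<open>K\<close>. By branching these are the sections of a single \<open>h\<close> in
  \<open>K\<close>, and the action of \<open>h\<close> on level \<open>n + 1\<close> determines the
  tuple.\<close>

lemma card_level_actions_Suc_ge:
  assumes K: "\<And>g. g \<in> K \<Longrightarrow> tree_aut m g"
    and branch: "(\<Pi>\<^sub>E i\<in>{1..m}. K) \<subseteq> psi m ` level_stab m K 1"
  shows "card (level_actions m K n) ^ m \<le> card (level_actions m K (Suc n))"
proof -
  \<comment> \<open>\<open>S\<close> recovers the first-level sections from an action on level
    \<open>n + 1\<close>: \<open>tl\<close> removes the image of the first letter. Sections of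
    arbitrary elements of \<open>K\<close> may lie outside \<open>K\<close>, hence an inclusion
    rather than an equality below.\<close>
  define S where "S = (\<lambda>s :: nat list \<Rightarrow> nat list.
    \<lambda>i\<in>{1..m}. restrict (\<lambda>u. tl (s (i # u))) (level m n))"
  have "(\<Pi>\<^sub>E i\<in>{1..m}. level_actions m K n) \<subseteq> S ` level_actions m K (Suc n)"
  proof
    fix r assume r: "r \<in> (\<Pi>\<^sub>E i\<in>{1..m}. level_actions m K n)"
    then have "\<forall>i\<in>{1..m}. \<exists>k\<in>K. r i = restrict k (level m n)"
      by (auto simp: level_actions_def PiE_iff)
    then obtain k where k: "\<And>i. i \<in> {1..m} \<Longrightarrow> k i \<in> K \<and> r i = restrict (k i) (level m n)"
      by metis
    then have "restrict k {1..m} \<in> (\<Pi>\<^sub>E i\<in>{1..m}. K)" by auto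
    then have "restrict k {1..m} \<in> psi m ` level_stab m K 1" using branch by (rule subsetD[rotated])
    then obtain h where h: "h \<in> K" "restrict k {1..m} = psi m h"
      unfolding level_stab_def by blast
    have hk: "k i = section_at h [i]" if "i \<in> {1..m}" for i
      using fun_cong[OF h(2), of i] that by (simp add: psi_def)
    have "r = S (restrict h (level m (Suc n)))"
    proof
      fix i
      show "r i = S (restrict h (level m (Suc n))) i"
      proof (cases "i \<in> {1..m}")
        case True
        then have "i # u \<in> level m (Suc n)" if "u \<in> level m n" for u
          using that by (auto simp: level_def tree_def)
        then show ?thesis
          using True k[OF True] hk[OF True]
          by (auto simp: S_def section_at_def drop_Suc fun_eq_iff restrict_def)
      next
        case False
        then show ?thesis using PiE_arb[OF r False] by (auto simp: S_def)
      qed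
    qed
    then show "r \<in> S ` level_actions m K (Suc n)" using h(1) by (auto simp: level_actions_def)
  qed
  then have "card (\<Pi>\<^sub>E i\<in>{1..m}. level_actions m K n) \<le> card (level_actions m K (Suc n))"
    by (intro surj_card_le finite_level_actions K)
  then show ?thesis by (simp add: card_PiE)
qed

lemma card_level_actions_branching:
  assumes K: "\<And>g. g \<in> K \<Longrightarrow> tree_aut m g"
    and branch: "(\<Pi>\<^sub>E i\<in>{1..m}. K) \<subseteq> psi m ` level_stab m K 1"
    and d: "2 \<le> card (level_actions m K d)"
  shows "2 ^ m ^ j \<le> card (level_actions m K (d + j))"
proof (induction j)
  case (Suc j)
  have "2 ^ m ^ Suc j = (2 ^ m ^ j :: nat) ^ m" by (simp add: power_mult[symmetric] mult.commute)
  also have "\<dots> \<le> card (level_actions m K (d + j)) ^ m" using Suc by (rule power_mono) simp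
  also have "\<dots> \<le> card (level_actions m K (d + Suc j))"
    using card_level_actions_Suc_ge[OF K branch] by simp
  finally show ?case .
qed (use d in simp)

lemma nontrivial_level_actions:
  assumes K: "\<And>g. g \<in> K \<Longrightarrow> tree_aut m g" and "id \<in> K" "K \<noteq> {id}"
  obtains d where "2 \<le> card (level_actions m K d)"
proof -
  obtain k where k: "k \<in> K" "k \<noteq> id" using assms by auto
  then obtain v where v: "k v \<noteq> v" by (auto simp: fun_eq_iff)
  \<comment> \<open>Automorphisms fix every word outside the tree, so a moved word is a vertex. On
    its level, \<open>k\<close> and \<open>id\<close> act differently.\<close>
  then have vt: "v \<in> tree m" using permutes_not_in[OF tree_autD(1)[OF K[OF k(1)]]] by blast
  let ?L = "level m (length v)"
  have "restrict k ?L v \<noteq> restrict id ?L v" using v vt by (simp add: level_def)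
  then have "restrict k ?L \<noteq> restrict id ?L" by metis
  then have "2 = card {restrict k ?L, restrict id ?L}" by simp
  also have "\<dots> \<le> card (level_actions m K (length v))"
    using k(1) \<open>id \<in> K\<close>
    by (intro card_mono finite_level_actions[OF K]) (auto simp: level_actions_def)
  finally show thesis by (rule that)
qed

lemma hdim_pos_if_branching_subset:
  assumes m: "m \<ge> 2" and H: "subgroup H (sym_group m)"
    and G: "subgroup G (Aut_tree m)" and GW: "G \<subseteq> wreath_set m H"
    and KG: "K \<subseteq> G" and idK: "id \<in> K" "K \<noteq> {id}"
    and branch: "(\<Pi>\<^sub>E i\<in>{1..m}. K) \<subseteq> psi m ` level_stab m K 1"
  shows "hdim m H G > 0"
proof -
  let ?W = "wreath_set m H"
  have W: "g \<in> ?W \<Longrightarrow> tree_aut m g" for g by (simp add: wreath_set_def Aut_tree_def)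
  have GA: "g \<in> G \<Longrightarrow> tree_aut m g" for g using GW W by blast
  have K: "g \<in> K \<Longrightarrow> tree_aut m g" for g using KG GA by blast
  obtain d where d: "2 \<le> card (level_actions m K d)"
    using nontrivial_level_actions[OF K idK] by blast
  \<comment> \<open>This is \<open>m ^ j * ln 2\<close>, from the lower bound for \<open>K\<close>,
    over \<open>m ^ (d + j + 1) * ln m\<close>, from the bound for the whole tree; the factor
    \<open>m ^ j\<close> cancels.\<close>
  let ?c = "ln 2 / (real m ^ Suc d * ln (real m))"
  have lnm: "ln (real m) > 0" using m by simp
  have c0: "0 < ?c" using lnm m by simp
  have "?c \<le> ln (real (level_index m G n)) / ln (real (level_index m ?W n))" if n: "n \<ge> d" for n
  proof -
    obtain j where j: "n = d + j" using n le_Suc_ex by blast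
    have "2 ^ m ^ j \<le> card (level_actions m K n)"
      using card_level_actions_branching[OF K branch d] j by simp
    also have "\<dots> \<le> card (level_actions m G n)"
      by (intro card_mono finite_level_actions[OF GA]) (use KG in \<open>auto simp: level_actions_def\<close>)
    finally have g: "2 ^ m ^ j \<le> card (level_actions m G n)" .
    also have gw: "card (level_actions m G n) \<le> card (level_actions m ?W n)"
      by (intro card_mono finite_level_actions[OF W]) (use GW in \<open>auto simp: level_actions_def\<close>)
    finally have w: "2 ^ m ^ j \<le> card (level_actions m ?W n)" .
    have "real (2 ^ m ^ j) \<le> real (card (level_actions m G n))" using g by (rule of_nat_mono)
    then have "ln (2 ^ m ^ j) \<le> ln (real (card (level_actions m G n)))"
      by (intro ln_mono) simp_all
    then have lg: "real m ^ j * ln 2 \<le> ln (real (card (level_actions m G n)))"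
      by (simp add: ln_realpow)
    \<comment> \<open>Since \<open>m ^ j\<close> is at least 1, the wreath product acts in at least
      two ways. Its logarithm is thus positive, and the quotient is not the default value of a
      division by zero.\<close>
    have "(2 :: nat) ^ 1 \<le> 2 ^ m ^ j" using m by (intro power_increasing) auto
    then have w2: "2 \<le> card (level_actions m ?W n)" using w by simp
    have "real (card (level_actions m ?W n)) \<le> real (m ^ m ^ Suc n)"
      using card_level_actions_le[OF W m] by (rule of_nat_mono)
    then have "ln (real (card (level_actions m ?W n))) \<le> ln (real m ^ m ^ Suc n)"
      using w2 m by (intro ln_mono) simp_all
    then have lw: "ln (real (card (level_actions m ?W n))) \<le> real m ^ Suc n * ln (real m)"
      using m by (simp add: ln_realpow)
    have "?c = (real m ^ j * ln 2) / (real m ^ Suc n * ln (real m))"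
      using m by (simp add: j power_add)
    also have "\<dots> \<le> ln (real (card (level_actions m G n))) / ln (real (card (level_actions m ?W n)))"
      by (rule frac_le) (use lg lw w2 in \<open>auto intro: order_trans[OF _ lg]\<close>)
    finally show ?thesis
      by (simp add: level_index_eq_card_level_actions[OF G]
          level_index_eq_card_level_actions[OF subgroup_wreath_set[OF H]])
  qed
  \<comment> \<open>The bound holds from level \<open>d\<close> on, which is enough for the limit
    inferior.\<close>
  then have "\<forall>\<^sub>F n in sequentially.
      ereal ?c \<le> ereal (ln (real (level_index m G n)) / ln (real (level_index m ?W n)))"
    by (auto intro: eventually_sequentiallyI)
  then have "ereal ?c \<le> hdim m H G" unfolding hdim_def by (rule Liminf_bounded)
  then show ?thesis using c0 by (metis ereal_less(2) less_le_trans)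
qed

theorem corollary6:
  fixes m :: nat and H :: "(nat \<Rightarrow> nat) set" and G :: "(nat list \<Rightarrow> nat list) set"
  assumes "m \<ge> 2"
    and "subgroup H (sym_group m)"
    and "subgroup G (wreath_group m H)"
    and "closedin (Aut_topology m) G"
    and "weakly_regular_branch m G"
  shows "subgroup G (wreath_group m H) \<and> closedin (Aut_topology m) G \<and>
    self_similar m G \<and> level_transitive m G \<and> hdim m H G > 0"
proof -
  \<comment> \<open>Apart from the positive dimension, every part of the conclusion is contained in
    the hypotheses.\<close>
  obtain K where G: "subgroup G (Aut_tree m)" "self_similar m G" "level_transitive m G"
    and K: "subgroup K ((Aut_tree m)\<lparr>carrier := G\<rparr>)" "K \<noteq> {\<one>\<^bsub>Aut_tree m\<^esub>}"
      "(\<Pi>\<^sub>E i\<in>{1..m}. K) \<subseteq> psi m ` level_stab m K 1"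
    using assms(5) by (auto simp: weakly_regular_branch_def branching_subgroup_def)
  have "G \<subseteq> wreath_set m H"
    using subgroup.subset[OF assms(3)] by (simp add: wreath_group_def)
  moreover have "K \<subseteq> G" using subgroup.subset[OF K(1)] by simp
  moreover have "id \<in> K" "K \<noteq> {id}"
    using subgroup.one_closed[OF K(1)] K(2) by (simp_all add: Aut_tree_def)
  ultimately have "hdim m H G > 0"
    using hdim_pos_if_branching_subset[OF assms(1,2) G(1) _ _ _ _ K(3)] by blast
  then show ?thesis using assms(3,4) G by blast
qed

end
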